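(* Let $\mu$ be a compactly supported Borel probability measure on $\mathbb{R}^d$. Suppose $\mu$ has a Bessel measure $\nu$ of positive lower Beurling density, i.e. $\mathcal{D}^-(\nu)>0$. Then $\mu$ is absolutely continuous with respect to the Lebesgue measure, and its Radon-Nikodym derivative is in $L^2(\mathbb{R}^d)$.
   Context: For $f\in L^1(\mu)$, put $\widehat{f\,d\mu}(t)=\int f(x)e^{-2\pi i t\cdot x}\,d\mu(x)$, $t\in\mathbb{R}^d$. A (nonnegative) Borel measure $\nu$ on $\mathbb{R}^d$ is a Bessel measure for $\mu$ if there is a constant $B>0$ such that $\|\widehat{f\,d\mu}\|_{L^2(\nu)}^2\le B\|f\|_{L^2(\mu)}^2$ for every $f\in L^2(\mu)$. With $Q=[0,1)^d$, the ($d$-)lower Beurling density of a locally finite Borel measure $\nu$ on $\mathbb{R}^d$ is $\mathcal{D}^-(\nu)=\liminf_{R\to\infty}\inf_{x\in\mathbb{R}^d}\frac{\nu(x+RQ)}{R^d}$. *)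

theory Defs
  imports "HOL-Analysis.Analysis" "HOL-Probability.Probability"
begin

definition measure_support :: "'a::topological_space measure \<Rightarrow> 'a set" where
  "measure_support M = {x. \<forall>U. open U \<and> x \<in> U \<longrightarrow> emeasure M U > 0}"

(* Complex-valued functions in L^2(M), before passing to almost-everywhere classes. *)
definition L2_functions :: "'a measure \<Rightarrow> ('a \<Rightarrow> complex) set" where
  "L2_functions M = {f \<in> borel_measurable M. integrable M (\<lambda>x. (cmod (f x))\<^sup>2)}"

definition fourier_measure ::
  "('a::euclidean_space \<Rightarrow> complex) \<Rightarrow> 'a measure \<Rightarrow> 'a \<Rightarrow> complex" where
  "fourier_measure f M t =
     (LINT x|M. f x * exp (- (2 * complex_of_real pi * \<i> * complex_of_real (t \<bullet> x))))"

(* N need not be finite, so the left-hand side is a nonnegative integral with values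
   in [0, \<infinity>]; the inequality includes its finiteness. *)
definition bessel_measure :: "'a::euclidean_space measure \<Rightarrow> 'a measure \<Rightarrow> bool" where
  "bessel_measure M N \<longleftrightarrow> sets N = sets borel \<and>
     (\<exists>B>0. \<forall>f \<in> L2_functions M.
        (\<integral>\<^sup>+ t. ennreal ((cmod (fourier_measure f M t))\<^sup>2) \<partial>N)
          \<le> ennreal (B * (LINT x|M. (cmod (f x))\<^sup>2)))"

definition unit_cube :: "'a::euclidean_space set" where
  "unit_cube = {q. \<forall>b\<in>Basis. 0 \<le> q \<bullet> b \<and> q \<bullet> b < 1}"

definition lower_beurling_density :: "'a::euclidean_space measure \<Rightarrow> ennreal" where
  "lower_beurling_density N =
     Liminf (at_top :: real filter)
       (\<lambda>R. INF x. emeasure N ((\<lambda>q. x + R *\<^sub>R q) ` unit_cube) / ennreal (R ^ DIM('a)))"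

end

theory Submission imports Defs begin

text \<open>
  Write \<open>F t = \<integral> exp (- 2 \<pi> \<i> t \<bullet> x) d\<mu>(x)\<close> for the Fourier transform of \<open>\<mu>\<close>, and call
  \<open>E = \<integral> |F|\<^sup>2\<close> (Lebesgue integral) its Fourier energy. The proof shows that \<open>E\<close> is finite and
  that finite energy forces \<open>\<mu>\<close> to have a density whose square integral is at most \<open>E\<close>.

  Finite energy (\<open>fourier_energy_finite\<close>). Applied to the unimodular function
  \<open>x \<mapsto> exp (- 2 \<pi> \<i> s \<bullet> x)\<close>, the Bessel inequality says \<open>\<integral> |F (t + s)|\<^sup>2 d\<nu>(t) \<le> B\<close> for every \<open>s\<close>.
  Integrating over all \<open>s\<close> in the reflected cube \<open>- R Q\<close> and exchanging the integrals gives
  \<open>\<integral> |F u|\<^sup>2 \<nu>(u + R Q) du \<le> B R\<^sup>d\<close>. Positive lower density provides one side length \<open>R\<close> for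
  which \<open>\<nu>(u + R Q)\<close> is bounded below by a positive constant, uniformly in \<open>u\<close>.

  From finite energy to a square-integrable density. In place of Plancherel's theorem one
  smooths \<open>\<mu>\<close> by a Gaussian. Products of Gaussians convolve explicitly, so the squared L2 norm
  of the smoothed measure is a double integral of a Gaussian of \<open>y - z\<close> against
  \<open>\<mu> \<times> \<mu>\<close>; since a Gaussian is itself the Fourier transform of a Gaussian bounded by 1,
  this is at most \<open>E\<close>, whatever the width (\<open>gauss_smoothing_L2\<close>). The Cauchy-Schwarz inequality and Fatou's
  lemma, as the width tends to 0, then yield the key inequality
  \<open>(\<integral> f d\<mu>)\<^sup>2 \<le> E \<integral> f\<^sup>2\<close> for nonnegative lower semicontinuous \<open>f\<close> (\<open>L2_bound_seq_lsc\<close>).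
  For indicators of open sets it gives absolute continuity. Once null sets are
  harmless, the inequality passes to bounded Borel functions with bounded support, which are
  almost everywhere limits of continuous ones. Testing it on truncations of the density \<open>h\<close>
  itself gives \<open>\<integral> h\<^sup>2 \<le> E\<close> (\<open>RN_deriv_L2_bound\<close>).
\<close>

section \<open>Gaussian kernels and their Fourier transforms\<close>

text \<open>
  The normalisation gives total mass 1; the width is of order \<open>1 / sqrt a\<close>, so the kernel
  concentrates at the origin as \<open>a\<close> grows.
\<close>
definition gauss_kernel :: "real \<Rightarrow> 'a::euclidean_space \<Rightarrow> real" where
  "gauss_kernel a x = sqrt a ^ DIM('a) * exp (- pi * a * (norm x)\<^sup>2)"

text \<open>
  The substitution \<open>t = sqrt (a / (2 \<pi>)) u\<close> turns the integrand into the standard normal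
  density times a phase, whose integral is the characteristic function of the normal
  distribution.
\<close>
lemma gauss_fourier_real:
  fixes a x :: real
  assumes a: "a > 0"
  shows "integrable lborel (\<lambda>t::real. exp (- pi * t\<^sup>2 / a))"
    and "(LINT t|lborel. complex_of_real (exp (- pi * t\<^sup>2 / a)) * exp (- (2 * complex_of_real pi * \<i> * complex_of_real (t * x))))
        = complex_of_real (sqrt a * exp (- pi * a * x\<^sup>2))"
proof -
  define c where "c = sqrt (a / (2 * pi))"
  have c: "c > 0" and c2: "c\<^sup>2 = a / (2 * pi)" using a by (auto simp: c_def)
  have E: "exp (- pi * (0 + c * u)\<^sup>2 / a) = sqrt (2 * pi) * std_normal_density u" for u
    using a by (simp add: std_normal_density_def power_mult_distrib c2 field_simps)
  have "integrable lborel (\<lambda>u. exp (- pi * (0 + c * u)\<^sup>2 / a))"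
    unfolding E by (intro integrable_mult_right integrable_normal_density) auto
  then show "integrable lborel (\<lambda>t::real. exp (- pi * t\<^sup>2 / a))"
    using lborel_integrable_real_affine_iff[of c "\<lambda>t. exp (- pi * t\<^sup>2 / a)" 0] c by simp
  have S: "sqrt (2 * pi) * c = sqrt a" using a by (simp add: c_def flip: real_sqrt_mult)
  have "(LINT t|lborel. complex_of_real (exp (- pi * t\<^sup>2 / a)) * exp (- (2 * complex_of_real pi * \<i> * complex_of_real (t * x))))
     = c *\<^sub>R (LINT u|lborel. complex_of_real (exp (- pi * (0 + c*u)\<^sup>2 / a)) * exp (- (2 * complex_of_real pi * \<i> * complex_of_real ((0 + c*u) * x))))"
    using c by (subst lborel_integral_real_affine[where c=c and t=0]) auto
  also have "\<dots> = c *\<^sub>R (LINT u|lborel. complex_of_real (sqrt (2 * pi)) * (std_normal_density u *\<^sub>R iexp ((- (2 * pi * c * x)) * u)))"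
    unfolding E by (simp add: scaleR_conv_of_real mult_ac)
  also have "\<dots> = c *\<^sub>R (complex_of_real (sqrt (2 * pi)) * (LINT u|lborel. std_normal_density u *\<^sub>R iexp ((- (2 * pi * c * x)) * u)))"
    by (subst integral_mult_right_zero) (rule refl)
  also have "\<dots> = c *\<^sub>R (complex_of_real (sqrt (2 * pi)) * char std_normal_distribution (- (2 * pi * c * x)))"
    unfolding char_def by (subst integral_density) auto
  also have "\<dots> = complex_of_real (sqrt a * exp (- (2 * pi * c * x)\<^sup>2 / 2))"
    unfolding char_std_normal_distribution S[symmetric] by (simp add: scaleR_conv_of_real)
  also have "(2 * pi * c * x)\<^sup>2 / 2 = pi * a * x\<^sup>2"
  proof -
    have "(2 * pi * c * x)\<^sup>2 / 2 = 2 * pi\<^sup>2 * x\<^sup>2 * c\<^sup>2" by (simp add: power2_eq_square)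
    then show ?thesis unfolding c2 by (simp add: power2_eq_square)
  qed
  then have "- (2 * pi * c * x)\<^sup>2 / 2 = - pi * a * x\<^sup>2" by simp
  finally show "(LINT t|lborel. complex_of_real (exp (- pi * t\<^sup>2 / a)) * exp (- (2 * complex_of_real pi * \<i> * complex_of_real (t * x))))
        = complex_of_real (sqrt a * exp (- pi * a * x\<^sup>2))" .
qed

lemma integral_lborel_prod:
  fixes f :: "'a::euclidean_space \<Rightarrow> real \<Rightarrow> 'b::{real_normed_field,banach,second_countable_topology}"
  assumes int: "\<And>b. b \<in> Basis \<Longrightarrow> integrable lborel (f b)"
  shows "integrable lborel (\<lambda>x::'a. \<Prod>b\<in>Basis. f b (x \<bullet> b))"
    and "(LINT x|lborel. (\<Prod>b\<in>Basis. f b (x \<bullet> b))) = (\<Prod>b\<in>Basis. LINT u|lborel. f b u)"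
proof -
  interpret product_sigma_finite "\<lambda>b::'a. lborel :: real measure" ..
  have [measurable]: "f b \<in> borel_measurable borel" if "b \<in> Basis" for b
    using borel_measurable_integrable[OF int[OF that]] by simp
  have *: "(\<Prod>b\<in>Basis. f b ((\<Sum>b\<in>Basis. g b *\<^sub>R b) \<bullet> b)) = (\<Prod>b\<in>Basis. f b (g b))" for g
    by (intro prod.cong) auto
  show "integrable lborel (\<lambda>x::'a. \<Prod>b\<in>Basis. f b (x \<bullet> b))"
    by (subst lborel_eq, subst integrable_distr_eq) (auto simp: * intro!: product_integrable_prod int)
  show "(LINT x|lborel. (\<Prod>b\<in>Basis. f b (x \<bullet> b))) = (\<Prod>b\<in>Basis. LINT u|lborel. f b u)"
    by (subst lborel_eq, subst integral_distr) (auto simp: * intro!: product_integral_prod int)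
qed

lemma norm_sq_Basis: "(norm (x::'a::euclidean_space))\<^sup>2 = (\<Sum>b\<in>Basis. (x \<bullet> b)\<^sup>2)"
  unfolding power2_norm_eq_inner by (subst euclidean_inner) (simp add: power2_eq_square)

text \<open>
  Both the Gaussian and the phase factor over the coordinates, which reduces the
  computation to dimension one.
\<close>
lemma gauss_kernel_fourier:
  fixes x :: "'a::euclidean_space"
  assumes a: "a > 0"
  shows "integrable lborel (\<lambda>t::'a. exp (- pi * (norm t)\<^sup>2 / a))"
    and "(LINT t|lborel. complex_of_real (exp (- pi * (norm t)\<^sup>2 / a)) * exp (- (2 * complex_of_real pi * \<i> * complex_of_real (t \<bullet> x))))
        = complex_of_real (gauss_kernel a x)"
proof -
  have *: "exp (- pi * (norm t)\<^sup>2 / a) = (\<Prod>b\<in>Basis. exp (- pi * (t \<bullet> b)\<^sup>2 / a))" for t :: 'a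
    by (simp add: norm_sq_Basis exp_sum[symmetric] sum_distrib_left sum_divide_distrib)
  show "integrable lborel (\<lambda>t::'a. exp (- pi * (norm t)\<^sup>2 / a))"
    unfolding * by (intro integral_lborel_prod gauss_fourier_real a)
  let ?f = "\<lambda>b t. complex_of_real (exp (- pi * t\<^sup>2 / a)) * exp (- (2 * complex_of_real pi * \<i> * complex_of_real (t * (x \<bullet> b))))"
  have int: "integrable lborel (?f b)" for b
    by (rule Bochner_Integration.integrable_bound[OF gauss_fourier_real(1)[OF a]]) (auto simp: norm_mult)
  have **: "complex_of_real (exp (- pi * (norm t)\<^sup>2 / a)) * exp (- (2 * complex_of_real pi * \<i> * complex_of_real (t \<bullet> x)))
     = (\<Prod>b\<in>Basis. ?f b (t \<bullet> b))" for t :: 'a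
    unfolding * of_real_prod prod.distrib
    by (simp add: euclidean_inner[of t x] exp_sum[symmetric] sum_distrib_left sum_negf)
  have "(LINT t|lborel. complex_of_real (exp (- pi * (norm t)\<^sup>2 / a)) * exp (- (2 * complex_of_real pi * \<i> * complex_of_real (t \<bullet> x))))
     = (\<Prod>b\<in>Basis. complex_of_real (sqrt a * exp (- pi * a * (x \<bullet> b)\<^sup>2)))"
    unfolding ** integral_lborel_prod(2)[OF int] gauss_fourier_real(2)[OF a] ..
  also have "\<dots> = complex_of_real (gauss_kernel a x)"
    unfolding of_real_prod[symmetric] prod.distrib
    by (simp add: gauss_kernel_def norm_sq_Basis exp_sum[symmetric] sum_distrib_left sum_negf)
  finally show "(LINT t|lborel. complex_of_real (exp (- pi * (norm t)\<^sup>2 / a)) * exp (- (2 * complex_of_real pi * \<i> * complex_of_real (t \<bullet> x))))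
     = complex_of_real (gauss_kernel a x)" .
qed

lemma gauss_kernel_nonneg[simp]: "a > 0 \<Longrightarrow> gauss_kernel a x \<ge> 0"
  by (simp add: gauss_kernel_def)

lemma borel_measurable_gauss_kernel[measurable]: "gauss_kernel a \<in> borel_measurable borel"
  unfolding gauss_kernel_def[abs_def] by measurable

text \<open>
  The integral is the Fourier transform at frequency 0 of the Gaussian with parameter
  \<open>1 / a\<close>.
\<close>
lemma nn_integral_gauss_kernel:
  assumes a: "a > 0"
  shows "(\<integral>\<^sup>+x. ennreal (gauss_kernel a (x :: 'a::euclidean_space)) \<partial>lborel) = 1"
proof -
  have b: "1 / a > 0" using a by simp
  have e: "exp (- pi * (norm t)\<^sup>2 / (1/a)) = exp (- pi * a * (norm t)\<^sup>2)" for t :: 'a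
    using a by (simp add: mult_ac)
  have i: "integrable lborel (gauss_kernel a :: 'a \<Rightarrow> real)"
    using gauss_kernel_fourier(1)[OF b, where 'a='a] unfolding gauss_kernel_def[abs_def] e
    by (rule integrable_mult_right)
  have "(LINT t::'a|lborel. complex_of_real (exp (- pi * a * (norm t)\<^sup>2))) = complex_of_real (sqrt (1/a) ^ DIM('a))"
    using gauss_kernel_fourier(2)[OF b, of "0::'a"] unfolding e by (simp add: gauss_kernel_def)
  then have "complex_of_real (LINT t::'a|lborel. exp (- pi * a * (norm t)\<^sup>2)) = complex_of_real (sqrt (1/a) ^ DIM('a))"
    unfolding integral_complex_of_real .
  then have "(LINT t::'a|lborel. exp (- pi * a * (norm t)\<^sup>2)) = sqrt (1/a) ^ DIM('a)"
    using of_real_eq_iff by blast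
  then have "(LINT x::'a|lborel. gauss_kernel a x) = (sqrt a * sqrt (1/a)) ^ DIM('a)"
    by (simp add: gauss_kernel_def power_mult_distrib)
  also have "\<dots> = 1" using a by (simp flip: real_sqrt_mult)
  finally show ?thesis using nn_integral_eq_integral[OF i] a by simp
qed

lemma nn_integral_lborel_translate:
  fixes f :: "'a::euclidean_space \<Rightarrow> ennreal"
  assumes [measurable]: "f \<in> borel_measurable borel"
  shows "(\<integral>\<^sup>+x. f (t + x) \<partial>lborel) = (\<integral>\<^sup>+x. f x \<partial>lborel)"
  by (subst (2) lborel_distr_plus[of t, symmetric]) (simp add: nn_integral_distr)

text \<open>
  By the parallelogram law, \<open>|x - y|\<^sup>2 + |x - z|\<^sup>2\<close> splits into a multiple of the squared
  distance of \<open>x\<close> from the midpoint of \<open>y\<close> and \<open>z\<close>, and a part that depends only on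
  \<open>y - z\<close>. The first part integrates to 1 after normalisation.
\<close>
lemma gauss_kernel_convolution:
  fixes y z :: "'a::euclidean_space"
  assumes a: "a > 0"
  shows "(\<integral>\<^sup>+x. ennreal (gauss_kernel a (x - y)) * ennreal (gauss_kernel a (x - z)) \<partial>lborel) = ennreal (gauss_kernel (a / 2) (y - z))"
proof -
  define m where "m = (1/2) *\<^sub>R (y + z)"
  have n: "(norm (x - y))\<^sup>2 + (norm (x - z))\<^sup>2 = 2 * (norm (- m + x))\<^sup>2 + (norm (y - z))\<^sup>2 / 2" for x
    unfolding m_def power2_norm_eq_inner
    by (simp add: inner_simps inner_commute field_simps)
  have s: "sqrt a ^ DIM('a) * sqrt a ^ DIM('a) = sqrt (a/2) ^ DIM('a) * sqrt (2 * a) ^ DIM('a)"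
    unfolding power_mult_distrib[symmetric] using a by (simp flip: real_sqrt_mult)
  have "gauss_kernel a (x - y) * gauss_kernel a (x - z) = gauss_kernel (a/2) (y - z) * gauss_kernel (2*a) (- m + x)" for x
  proof -
    have "gauss_kernel a (x - y) * gauss_kernel a (x - z) = (sqrt a ^ DIM('a) * sqrt a ^ DIM('a)) * exp (- pi * a * ((norm (x - y))\<^sup>2 + (norm (x - z))\<^sup>2))"
      by (simp add: gauss_kernel_def exp_add[symmetric] algebra_simps)
    also have "\<dots> = gauss_kernel (a/2) (y - z) * gauss_kernel (2*a) (- m + x)"
      unfolding n s by (simp add: gauss_kernel_def exp_add[symmetric] algebra_simps)
    finally show ?thesis .
  qed
  then have "(\<integral>\<^sup>+x. ennreal (gauss_kernel a (x - y)) * ennreal (gauss_kernel a (x - z)) \<partial>lborel)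
     = (\<integral>\<^sup>+x. ennreal (gauss_kernel (a/2) (y - z)) * ennreal (gauss_kernel (2*a) (- m + x)) \<partial>lborel)"
    using a by (simp flip: ennreal_mult)
  also have "\<dots> = ennreal (gauss_kernel (a/2) (y - z))"
    using a nn_integral_lborel_translate[of "\<lambda>x. ennreal (gauss_kernel (2*a) x)" "-m"]
    by (simp add: nn_integral_cmult nn_integral_gauss_kernel)
  finally show ?thesis .
qed

section \<open>The Fourier energy of a probability measure\<close>

abbreviation character :: "'a::euclidean_space \<Rightarrow> 'a \<Rightarrow> complex" where
  "character t x \<equiv> exp (- (2 * complex_of_real pi * \<i> * complex_of_real (t \<bullet> x)))"

abbreviation fourier_stieltjes :: "'a::euclidean_space measure \<Rightarrow> 'a \<Rightarrow> complex" where
  "fourier_stieltjes M \<equiv> fourier_measure (\<lambda>_. 1) M"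

definition fourier_energy :: "'a::euclidean_space measure \<Rightarrow> ennreal" where
  "fourier_energy M = (\<integral>\<^sup>+t. ennreal ((cmod (fourier_stieltjes M t))\<^sup>2) \<partial>lborel)"

lemma continuous_fourier_stieltjes:
  fixes M :: "'a::euclidean_space measure"
  assumes "prob_space M" and [measurable_cong]: "sets M = sets borel"
  shows "continuous_on UNIV (fourier_stieltjes M)"
proof -
  interpret prob_space M by fact
  have "isCont (fourier_stieltjes M) t" for t
    unfolding continuous_at_sequentially fourier_measure_def o_def
  proof (intro allI impI, rule integral_dominated_convergence[where w="\<lambda>_. 1"])
    fix X :: "nat \<Rightarrow> 'a" assume X: "X \<longlonglongrightarrow> t"
    show "AE x in M. (\<lambda>i. 1 * character (X i) x) \<longlonglongrightarrow> 1 * character t x"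
      by (intro AE_I2 tendsto_intros X)
  qed auto
  then show ?thesis by (simp add: continuous_on_eq_continuous_at)
qed

lemma cmod_fourier_stieltjes_le_1:
  assumes "prob_space M"
  shows "cmod (fourier_stieltjes M t) \<le> 1"
proof -
  interpret prob_space M by fact
  have "cmod (fourier_stieltjes M t) \<le> (LINT x|M. cmod (character t x))"
    unfolding fourier_measure_def mult_1 by (rule integral_norm_bound)
  then show ?thesis by (simp add: prob_space)
qed

text \<open>
  Fubini's theorem in the shape in which the Gaussian identity is integrated against the
  measure twice: \<open>g\<close> is the integrable Gaussian weight, possibly times a bounded factor, and
  \<open>k\<close> is a phase.
\<close>
lemma integral_swap_bounded:
  fixes M :: "'a::euclidean_space measure" and g :: "'a \<Rightarrow> complex" and k :: "'a \<Rightarrow> 'a \<Rightarrow> complex"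
  assumes "prob_space M" and [measurable_cong]: "sets M = sets borel"
    and g: "integrable lborel g"
    and k[measurable]: "case_prod k \<in> borel_measurable borel" and k1: "\<And>y t. cmod (k y t) \<le> 1"
  shows "(LINT y|M. LINT t|lborel. g t * k y t) = (LINT t|lborel. g t * (LINT y|M. k y t))"
proof -
  interpret prob_space M by fact
  interpret pair_sigma_finite M lborel ..
  have [measurable]: "g \<in> borel_measurable borel" using borel_measurable_integrable[OF g] by simp
  have k'[measurable]: "(\<lambda>p. k (fst p) (snd p)) \<in> borel_measurable (borel \<Otimes>\<^sub>M borel)"
    using k by (simp add: borel_prod case_prod_beta')
  have [measurable]: "(\<lambda>t. k y t) \<in> borel_measurable borel" for y
    using measurable_compose[OF measurable_Pair1' k', of y] by simp
  have bound: "norm (g t * k y t) \<le> norm (g t)" for y t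
    using mult_left_mono[OF k1, of "norm (g t)"] by (simp add: norm_mult)
  have int: "integrable (M \<Otimes>\<^sub>M lborel) (case_prod (\<lambda>y t. g t * k y t))"
  proof (rule Fubini_integrable)
    show m[measurable]: "(\<lambda>(y, t). g t * k y t) \<in> borel_measurable (M \<Otimes>\<^sub>M lborel)"
      unfolding case_prod_beta' by measurable
    have i: "integrable lborel (\<lambda>t. g t * k y t)" for y
      by (rule Bochner_Integration.integrable_bound[OF g]) (use bound in \<open>auto\<close>)
    then show "AE y in M. integrable lborel (\<lambda>t. case (y, t) of (y, t) \<Rightarrow> g t * k y t)" by simp
    show "integrable M (\<lambda>y. LINT t|lborel. norm (case (y, t) of (y, t) \<Rightarrow> g t * k y t))"
    proof (rule integrable_const_bound[where B="LINT t|lborel. norm (g t)"])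
      have "(LINT t|lborel. norm (g t * k y t)) \<le> (LINT t|lborel. norm (g t))" for y
        by (intro integral_mono integrable_norm i g bound)
      then show "AE y in M. norm (LINT t|lborel. norm (case (y, t) of (y, t) \<Rightarrow> g t * k y t)) \<le> (LINT t|lborel. norm (g t))"
        by (simp add: norm_mult)
    qed measurable
  qed
  have "(LINT y|M. LINT t|lborel. g t * k y t) = (LINT t|lborel. LINT y|M. g t * k y t)"
    by (rule Fubini_integral[OF int, symmetric])
  then show ?thesis by simp
qed

text \<open>
  Writing the kernel as the Fourier integral of \<open>g t = exp (- \<pi> |t|\<^sup>2 / a)\<close> and splitting the
  phase as \<open>exp (- 2 \<pi> \<i> t \<bullet> y)\<close> times the conjugate of \<open>exp (- 2 \<pi> \<i> t \<bullet> z)\<close>, the two integrations over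
  the measure produce the transform and its conjugate. The left-hand side is therefore the
  integral of \<open>g |F|\<^sup>2\<close>, and \<open>g \<le> 1\<close>.
\<close>
lemma gauss_kernel_energy:
  fixes M :: "'a::euclidean_space measure"
  assumes "prob_space M" and [measurable_cong]: "sets M = sets borel" and a: "a > 0"
  shows "(\<integral>\<^sup>+y. \<integral>\<^sup>+z. ennreal (gauss_kernel a (y - z)) \<partial>M \<partial>M) \<le> fourier_energy M"
proof -
  interpret prob_space M by fact
  let ?g = "\<lambda>t::'a. exp (- pi * (norm t)\<^sup>2 / a)"
  let ?F = "fourier_stieltjes M"
  have F[measurable]: "?F \<in> borel_measurable borel"
    by (rule borel_measurable_continuous_onI[OF continuous_fourier_stieltjes[OF assms(1,2)]])
  have [measurable]: "(\<lambda>t. cnj (?F t)) \<in> borel_measurable borel"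
    by (rule measurable_compose[OF F]) (intro borel_measurable_continuous_onI continuous_intros)
  have gi: "integrable lborel ?g" using gauss_kernel_fourier(1)[OF a] .
  have K: "gauss_kernel a (y - z) \<le> sqrt a ^ DIM('a)" for y z :: 'a
    using a mult_left_mono[of "exp (- pi * a * (norm (y - z))\<^sup>2)" 1 "sqrt a ^ DIM('a)"] by (simp add: gauss_kernel_def)
  have Ki: "integrable M (\<lambda>z. gauss_kernel a (y - z))" for y
    by (rule integrable_const_bound[where B="sqrt a ^ DIM('a)"]) (use K a in auto)
  have KKi: "integrable M (\<lambda>y. LINT z|M. gauss_kernel a (y - z))"
  proof (rule integrable_const_bound[where B="sqrt a ^ DIM('a)"])
    have "(LINT z|M. gauss_kernel a (y - z)) \<le> sqrt a ^ DIM('a)" for y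
      by (rule integral_le_const[OF Ki]) (use K in auto)
    moreover have "0 \<le> (LINT z|M. gauss_kernel a (y - z))" for y
      using a by (intro integral_nonneg_AE) auto
    ultimately show "AE y in M. norm (LINT z|M. gauss_kernel a (y - z)) \<le> sqrt a ^ DIM('a)" by simp
  qed measurable
  have char_diff: "character t (y - z) = character t y * cnj (character t z)" for t y z :: 'a
    by (simp add: exp_cnj inner_diff_right exp_add[symmetric] algebra_simps)
  have inner: "complex_of_real (LINT z|M. gauss_kernel a (y - z)) = (LINT t|lborel. (complex_of_real (?g t) * cnj (?F t)) * character t y)" for y
  proof -
    have i: "integrable lborel (\<lambda>t. complex_of_real (?g t) * character t y)"
      by (rule Bochner_Integration.integrable_bound[OF gi]) (auto simp: norm_mult)
    have "complex_of_real (LINT z|M. gauss_kernel a (y - z)) = (LINT z|M. LINT t|lborel. (complex_of_real (?g t) * character t y) * cnj (character t z))"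
      unfolding integral_complex_of_real[symmetric] gauss_kernel_fourier(2)[OF a, symmetric] char_diff
      by (simp add: mult_ac)
    also have "\<dots> = (LINT t|lborel. (complex_of_real (?g t) * character t y) * (LINT z|M. cnj (character t z)))"
      by (rule integral_swap_bounded[OF assms(1,2) i]) (auto simp: case_prod_beta' intro!: borel_measurable_continuous_onI continuous_intros)
    finally show ?thesis by (simp add: fourier_measure_def mult_ac del: complex_cnj_mult exp_cnj)
  qed
  have i2: "integrable lborel (\<lambda>t. complex_of_real (?g t) * cnj (?F t))"
    by (rule Bochner_Integration.integrable_bound[OF gi])
       (auto simp: norm_mult intro!: mult_left_le cmod_fourier_stieltjes_le_1 assms(1))
  have "complex_of_real (LINT y|M. LINT z|M. gauss_kernel a (y - z)) = (LINT y|M. complex_of_real (LINT z|M. gauss_kernel a (y - z)))"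
    by (rule integral_complex_of_real[symmetric])
  also have "\<dots> = (LINT t|lborel. (complex_of_real (?g t) * cnj (?F t)) * (LINT y|M. character t y))"
    unfolding inner
    by (rule integral_swap_bounded[OF assms(1,2) i2]) (auto simp: case_prod_beta' intro!: borel_measurable_continuous_onI continuous_intros)
  also have "\<dots> = (LINT t|lborel. complex_of_real (?g t * (cmod (?F t))\<^sup>2))"
  proof (rule Bochner_Integration.integral_cong[OF refl])
    fix t
    have "(LINT y|M. character t y) = ?F t" by (simp add: fourier_measure_def)
    moreover have "?F t * cnj (?F t) = complex_of_real ((cmod (?F t))\<^sup>2)"
      by (rule complex_norm_square[symmetric])
    ultimately show "complex_of_real (?g t) * cnj (?F t) * (LINT y|M. character t y) = complex_of_real (?g t * (cmod (?F t))\<^sup>2)"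
      by (metis mult.assoc mult.commute of_real_mult)
  qed
  finally have eq: "(LINT y|M. LINT z|M. gauss_kernel a (y - z)) = (LINT t|lborel. ?g t * (cmod (?F t))\<^sup>2)"
    unfolding integral_complex_of_real of_real_eq_iff .
  have i3: "integrable lborel (\<lambda>t. ?g t * (cmod (?F t))\<^sup>2)"
    by (rule Bochner_Integration.integrable_bound[OF gi])
       (auto simp: power_le_one cmod_fourier_stieltjes_le_1 assms(1) intro!: mult_left_le)
  have "(\<integral>\<^sup>+y. \<integral>\<^sup>+z. ennreal (gauss_kernel a (y - z)) \<partial>M \<partial>M) = ennreal (LINT y|M. LINT z|M. gauss_kernel a (y - z))"
    using a by (simp add: nn_integral_eq_integral Ki KKi)
  also have "\<dots> = (\<integral>\<^sup>+t. ennreal (?g t * (cmod (?F t))\<^sup>2) \<partial>lborel)"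
    unfolding eq by (rule nn_integral_eq_integral[OF i3, symmetric]) simp
  also have "\<dots> \<le> fourier_energy M"
    unfolding fourier_energy_def
    by (intro nn_integral_mono ennreal_leI mult_left_le_one_le) (use a in auto)
  finally show ?thesis .
qed

section \<open>Gaussian smoothing and the L2 inequality\<close>

definition gauss_smoothing :: "real \<Rightarrow> 'a::euclidean_space measure \<Rightarrow> 'a \<Rightarrow> ennreal" where
  "gauss_smoothing a M x = (\<integral>\<^sup>+y. ennreal (gauss_kernel a (x - y)) \<partial>M)"

lemma borel_measurable_gauss_smoothing:
  assumes "prob_space M" and [measurable_cong]: "sets M = sets borel"
  shows "gauss_smoothing a M \<in> borel_measurable borel"
proof -
  interpret prob_space M by fact
  show ?thesis unfolding gauss_smoothing_def[abs_def] by measurable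
qed

text \<open>
  Expanding the square gives a double integral over the measure of the convolution of two
  kernels, which is again a kernel, with parameter \<open>a / 2\<close>.
\<close>
lemma gauss_smoothing_L2:
  fixes M :: "'a::euclidean_space measure"
  assumes "prob_space M" and [measurable_cong]: "sets M = sets borel" and a: "a > 0"
  shows "(\<integral>\<^sup>+x. (gauss_smoothing a M x)\<^sup>2 \<partial>lborel) \<le> fourier_energy M"
proof -
  interpret prob_space M by fact
  interpret pair_sigma_finite M lborel ..
  let ?k = "\<lambda>x y::'a. ennreal (gauss_kernel a (x - y))"
  have "(\<integral>\<^sup>+x. (gauss_smoothing a M x)\<^sup>2 \<partial>lborel) = (\<integral>\<^sup>+x. \<integral>\<^sup>+y. \<integral>\<^sup>+z. ?k x y * ?k x z \<partial>M \<partial>M \<partial>lborel)"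
    by (simp add: gauss_smoothing_def power2_eq_square nn_integral_cmult nn_integral_multc)
  also have "\<dots> = (\<integral>\<^sup>+y. \<integral>\<^sup>+x. \<integral>\<^sup>+z. ?k x y * ?k x z \<partial>M \<partial>lborel \<partial>M)"
    by (rule Fubini') measurable
  also have "\<dots> = (\<integral>\<^sup>+y. \<integral>\<^sup>+z. \<integral>\<^sup>+x. ?k x y * ?k x z \<partial>lborel \<partial>M \<partial>M)"
    by (intro nn_integral_cong Fubini') measurable
  also have "\<dots> = (\<integral>\<^sup>+y. \<integral>\<^sup>+z. ennreal (gauss_kernel (a/2) (y - z)) \<partial>M \<partial>M)"
    by (simp add: gauss_kernel_convolution a)
  also have "\<dots> \<le> fourier_energy M"
    using a by (intro gauss_kernel_energy assms) auto
  finally show ?thesis .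
qed

text \<open>
  Moving the scale from the kernel into the argument of \<open>f\<close> leaves a fixed weight, so that
  Fatou's lemma applies as \<open>r\<close> tends to infinity.
\<close>
lemma nn_integral_gauss_rescale:
  fixes f :: "'a::euclidean_space \<Rightarrow> ennreal"
  assumes [measurable]: "f \<in> borel_measurable borel" and r: "r > 0"
  shows "(\<integral>\<^sup>+x. f x * ennreal (gauss_kernel (r\<^sup>2) (x - y)) \<partial>lborel)
       = (\<integral>\<^sup>+z. f (y + (1 / r) *\<^sub>R z) * ennreal (gauss_kernel 1 z) \<partial>lborel)"
proof -
  have k: "(1 / r) ^ DIM('a) * gauss_kernel (r\<^sup>2) ((1 / r) *\<^sub>R z) = gauss_kernel 1 z" for z :: 'a
    using r by (simp add: gauss_kernel_def power_divide)
  have "(\<integral>\<^sup>+x. f x * ennreal (gauss_kernel (r\<^sup>2) (x - y)) \<partial>lborel)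
     = (\<integral>\<^sup>+z. ennreal (\<bar>1 / r\<bar> ^ DIM('a)) * (f (y + (1/r) *\<^sub>R z) * ennreal (gauss_kernel (r\<^sup>2) (y + (1/r) *\<^sub>R z - y))) \<partial>lborel)"
    using r by (subst lborel_affine[of "1 / r" y]) (simp_all add: nn_integral_density nn_integral_distr)
  also have "\<dots> = (\<integral>\<^sup>+z. f (y + (1/r) *\<^sub>R z) * ennreal (gauss_kernel 1 z) \<partial>lborel)"
  proof (rule nn_integral_cong)
    fix z :: 'a
    have "ennreal (\<bar>1 / r\<bar> ^ DIM('a)) * ennreal (gauss_kernel (r\<^sup>2) ((1/r) *\<^sub>R z)) = ennreal (gauss_kernel 1 z)"
      using r by (subst ennreal_mult[symmetric]) (auto simp flip: k)
    then show "ennreal (\<bar>1 / r\<bar> ^ DIM('a)) * (f (y + (1/r) *\<^sub>R z) * ennreal (gauss_kernel (r\<^sup>2) (y + (1/r) *\<^sub>R z - y)))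
      = f (y + (1/r) *\<^sub>R z) * ennreal (gauss_kernel 1 z)"
      by (subst mult.left_commute) simp
  qed
  finally show ?thesis .
qed

lemma mult_liminf_le_liminf_mult:
  fixes c :: ennreal
  shows "c * liminf u \<le> liminf (\<lambda>n. u n * c)"
  unfolding liminf_SUP_INF SUP_mult_left_ennreal
  by (intro SUP_mono bexI[where x=n for n] INF_greatest) (auto simp: mult.commute intro!: mult_left_mono INF_lower)

text \<open>
  Integrating \<open>f\<close> against the smoothed measure is bounded by the Cauchy-Schwarz inequality and
  \<open>gauss_smoothing_L2\<close>, uniformly in the width. Rescaled, these integrals average \<open>f\<close> over
  points \<open>y + z / r\<close> that tend to \<open>y\<close>, so lower semicontinuity is exactly what Fatou's lemma
  needs in order to bound \<open>\<integral> f dM\<close> by their lower limit.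
\<close>
lemma L2_bound_seq_lsc:
  fixes M :: "'a::euclidean_space measure" and f :: "'a \<Rightarrow> ennreal"
  assumes M: "prob_space M" and [measurable_cong]: "sets M = sets borel"
    and f[measurable]: "f \<in> borel_measurable borel"
    and lsc: "\<And>x w. w \<longlonglongrightarrow> x \<Longrightarrow> f x \<le> liminf (\<lambda>n. f (w n))"
  shows "(\<integral>\<^sup>+x. f x \<partial>M)\<^sup>2 \<le> fourier_energy M * (\<integral>\<^sup>+x. (f x)\<^sup>2 \<partial>lborel)"
proof -
  interpret prob_space M by fact
  interpret pair_sigma_finite M lborel ..
  let ?G = "\<lambda>z::'a. ennreal (gauss_kernel 1 z)"
  let ?C = "fourier_energy M * (\<integral>\<^sup>+x. (f x)\<^sup>2 \<partial>lborel)"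
  let ?r = "\<lambda>n. real (Suc n)"
  note [measurable] = borel_measurable_gauss_smoothing[OF assms(1,2)]
  define T where "T n = (\<integral>\<^sup>+y. \<integral>\<^sup>+z. f (y + (1 / ?r n) *\<^sub>R z) * ?G z \<partial>lborel \<partial>M)" for n
  \<comment> \<open>\<open>T n\<close> is the integral of \<open>f\<close> against the measure smoothed at a width of order \<open>1 / (n + 1)\<close>.\<close>
  have T: "(T n)\<^sup>2 \<le> ?C" for n
  proof -
    have "T n = (\<integral>\<^sup>+y. \<integral>\<^sup>+x. f x * ennreal (gauss_kernel ((?r n)\<^sup>2) (x - y)) \<partial>lborel \<partial>M)"
      unfolding T_def by (subst nn_integral_gauss_rescale) auto
    also have "\<dots> = (\<integral>\<^sup>+x. \<integral>\<^sup>+y. f x * ennreal (gauss_kernel ((?r n)\<^sup>2) (x - y)) \<partial>M \<partial>lborel)"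
      by (rule Fubini'[symmetric]) measurable
    also have "\<dots> = (\<integral>\<^sup>+x. gauss_smoothing ((?r n)\<^sup>2) M x * f x \<partial>lborel)"
      unfolding gauss_smoothing_def by (simp add: nn_integral_cmult mult.commute)
    finally have "(T n)\<^sup>2 \<le> (\<integral>\<^sup>+x. (gauss_smoothing ((?r n)\<^sup>2) M x)\<^sup>2 \<partial>lborel) * (\<integral>\<^sup>+x. (f x)\<^sup>2 \<partial>lborel)"
      by (simp only:) (rule Cauchy_Schwarz_nn_integral, measurable)
    also have "\<dots> \<le> ?C"
      by (intro mult_right_mono gauss_smoothing_L2 assms) auto
    finally show ?thesis .
  qed
  have "(\<integral>\<^sup>+y. f y \<partial>M) = (\<integral>\<^sup>+y. \<integral>\<^sup>+z. f y * ?G z \<partial>lborel \<partial>M)"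
    by (simp add: nn_integral_cmult nn_integral_gauss_kernel)
  also have "\<dots> \<le> (\<integral>\<^sup>+y. \<integral>\<^sup>+z. liminf (\<lambda>n. f (y + (1 / ?r n) *\<^sub>R z) * ?G z) \<partial>lborel \<partial>M)"
  proof (intro nn_integral_mono)
    fix y z :: 'a
    have "(\<lambda>n. y + (1 / ?r n) *\<^sub>R z) \<longlonglongrightarrow> y + 0 *\<^sub>R z"
      by (intro tendsto_intros LIMSEQ_Suc[OF lim_1_over_n])
    then have "f y \<le> liminf (\<lambda>n. f (y + (1 / ?r n) *\<^sub>R z))" by (intro lsc) simp
    then have "f y * ?G z \<le> ?G z * liminf (\<lambda>n. f (y + (1 / ?r n) *\<^sub>R z))"
      by (subst mult.commute) (rule mult_left_mono, auto)
    also have "\<dots> \<le> liminf (\<lambda>n. f (y + (1 / ?r n) *\<^sub>R z) * ?G z)"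
      by (rule mult_liminf_le_liminf_mult)
    finally show "f y * ?G z \<le> liminf (\<lambda>n. f (y + (1 / ?r n) *\<^sub>R z) * ?G z)" .
  qed
  also have "\<dots> \<le> (\<integral>\<^sup>+y. liminf (\<lambda>n. \<integral>\<^sup>+z. f (y + (1 / ?r n) *\<^sub>R z) * ?G z \<partial>lborel) \<partial>M)"
    by (intro nn_integral_mono nn_integral_liminf) measurable
  also have "\<dots> \<le> liminf T"
    unfolding T_def by (intro nn_integral_liminf) measurable
  finally have lim: "(\<integral>\<^sup>+y. f y \<partial>M) \<le> liminf T" .
  \<comment> \<open>Squaring is exchanged with the lower limit by taking the real square root of the bound.\<close>
  show ?thesis
  proof (cases ?C)
    case (real c)
    have "T n \<le> ennreal (sqrt c)" for n
    proof (cases "T n")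
      case (real t)
      then have "t\<^sup>2 \<le> c" using T[of n] \<open>?C = ennreal c\<close> \<open>0 \<le> c\<close> by (simp add: ennreal_power)
      then show ?thesis using real by (auto intro!: ennreal_leI real_le_rsqrt)
    next
      case top
      then show ?thesis using T[of n] real by (simp add: power2_eq_square top_unique ennreal_top_mult)
    qed
    then have "liminf T \<le> ennreal (sqrt c)"
      by (intro Liminf_le) auto
    with lim have "(\<integral>\<^sup>+y. f y \<partial>M) \<le> ennreal (sqrt c)" by simp
    then have "(\<integral>\<^sup>+y. f y \<partial>M)\<^sup>2 \<le> (ennreal (sqrt c))\<^sup>2" by (rule power_mono) simp
    then show ?thesis using real by (simp add: ennreal_power)
  qed simp
qed

section \<open>Densities of measures of finite Fourier energy\<close>

lemma L2_bound_open:
  fixes M :: "'a::euclidean_space measure"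
  assumes "prob_space M" "sets M = sets borel" and U: "open U"
  shows "(emeasure M U)\<^sup>2 \<le> fourier_energy M * emeasure lborel U"
proof -
  have [measurable]: "U \<in> sets borel" using U by simp
  have "(\<integral>\<^sup>+x. indicator U x \<partial>M)\<^sup>2 \<le> fourier_energy M * (\<integral>\<^sup>+x. (indicator U x)\<^sup>2 \<partial>lborel)"
  proof (rule L2_bound_seq_lsc[OF assms(1,2)])
    fix x and w :: "nat \<Rightarrow> 'a" assume w: "w \<longlonglongrightarrow> x"
    show "(indicator U x :: ennreal) \<le> liminf (\<lambda>n. indicator U (w n))"
    proof (cases "x \<in> U")
      case True
      have "eventually (\<lambda>n. w n \<in> U) sequentially"
        using topological_tendstoD[OF w U True] .
      then show ?thesis
        by (intro Liminf_bounded) (auto elim!: eventually_mono simp: True)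
    qed simp
  qed measurable
  moreover have "(indicator U x :: ennreal)\<^sup>2 = indicator U x" for x
    by (simp add: indicator_def)
  ultimately show ?thesis using assms by simp
qed

text \<open>
  A Lebesgue null set is contained in open sets of arbitrarily small volume, and
  \<open>L2_bound_open\<close> bounds their measure by a multiple of the square root of the volume.
\<close>
lemma absolutely_continuous_if_finite_energy:
  fixes M :: "'a::euclidean_space measure"
  assumes "prob_space M" "sets M = sets borel" and E: "fourier_energy M < \<infinity>"
  shows "absolutely_continuous lborel M"
  unfolding absolutely_continuous_def
proof
  fix A :: "'a set" assume A: "A \<in> null_sets lborel"
  then have Am: "A \<in> sets borel" and A0: "emeasure lborel A = 0" by auto
  have "(emeasure M A)\<^sup>2 \<le> fourier_energy M * ennreal e" if e: "e > 0" for e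
  proof -
    obtain U where U: "open U" "A \<subseteq> U" "emeasure lborel (U - A) < e"
      using outer_regular_lborel[OF Am e] by blast
    have "emeasure lborel U = emeasure lborel (U - A)"
      using A U by (simp add: emeasure_Diff_null_set)
    then have "emeasure lborel U \<le> e" using U by simp
    have "(emeasure M A)\<^sup>2 \<le> (emeasure M U)\<^sup>2"
      using U assms(2) by (intro power_mono emeasure_mono) auto
    also have "\<dots> \<le> fourier_energy M * emeasure lborel U"
      by (rule L2_bound_open[OF assms(1,2) U(1)])
    also have "\<dots> \<le> fourier_energy M * ennreal e"
      by (intro mult_left_mono) (use \<open>emeasure lborel U \<le> e\<close> in auto)
    finally show ?thesis .
  qed
  then have "(emeasure M A)\<^sup>2 \<le> fourier_energy M * ennreal (1 / real (Suc n))" for n by simp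
  moreover have "(\<lambda>n. fourier_energy M * ennreal (1 / real (Suc n))) \<longlonglongrightarrow> fourier_energy M * ennreal 0"
    using E by (intro ennreal_tendsto_cmult tendsto_ennrealI LIMSEQ_Suc[OF lim_1_over_n]) auto
  ultimately have "(emeasure M A)\<^sup>2 \<le> fourier_energy M * ennreal 0"
    by (intro LIMSEQ_le_const) auto
  then show "A \<in> null_sets M" using Am assms(2) by auto
qed

text \<open>
  A Borel function is the limit of continuous functions outside a Lebesgue null set, and by
  absolute continuity this set is also null for \<open>M\<close>. Clamping the approximations to
  \<open>[0, c]\<close> and cutting them off outside the ball of radius \<open>R + 1\<close> makes dominated
  convergence applicable on both sides of the inequality.
\<close>
lemma L2_bound_bounded_compact_support:
  fixes M :: "'a::euclidean_space measure" and f :: "'a \<Rightarrow> real"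
  assumes "prob_space M" and M[measurable_cong]: "sets M = sets borel" and E: "fourier_energy M < \<infinity>"
    and f[measurable]: "f \<in> borel_measurable borel"
    and f0: "\<And>x. 0 \<le> f x" and fc: "\<And>x. f x \<le> c" and fR: "\<And>x. norm x > R \<Longrightarrow> f x = 0"
  shows "(\<integral>\<^sup>+x. ennreal (f x) \<partial>M)\<^sup>2 \<le> fourier_energy M * (\<integral>\<^sup>+x. (ennreal (f x))\<^sup>2 \<partial>lborel)"
proof -
  interpret prob_space M by fact
  have "f measurable_on UNIV"
    by (rule lebesgue_measurable_imp_measurable_on_real) (use f in \<open>auto simp: measurable_completion\<close>)
  then obtain N g where N: "negligible N" and g: "\<And>n. continuous_on UNIV (g n)"
    and lim: "\<And>x. x \<notin> N \<Longrightarrow> (\<lambda>n. g n x) \<longlonglongrightarrow> f x"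
    unfolding measurable_on_def by auto
  obtain N' where N': "N' \<in> null_sets lborel" "N \<subseteq> N'"
    using N unfolding negligible_iff_null_sets null_sets_completion_iff2 by blast
  have N'M: "N' \<in> null_sets M"
    using absolutely_continuous_if_finite_energy[OF assms(1-3)] N'(1) by (auto simp: absolutely_continuous_def)
  define u where "u n x = max 0 (min c (g n x)) * max 0 (min 1 (R + 1 - norm x))" for n x
  have [measurable]: "cball 0 r \<in> sets (borel :: 'a measure)" for r by simp
  have uc: "continuous_on UNIV (u n)" for n
    unfolding u_def by (intro continuous_intros g)
  have um[measurable]: "u n \<in> borel_measurable borel" for n
    by (rule borel_measurable_continuous_onI[OF uc])
  have c0: "c \<ge> 0" using f0[of 0] fc[of 0] by linarith
  have u0: "0 \<le> u n x" for n x by (simp add: u_def)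
  have ub: "u n x \<le> c * indicator (cball 0 (R + 1)) x" for n x
  proof (cases "norm x \<le> R + 1")
    case True
    have "u n x \<le> c * 1" unfolding u_def by (intro mult_mono) (use c0 in auto)
    then show ?thesis using True by simp
  qed (simp add: u_def)
  have ul: "(\<lambda>n. u n x) \<longlonglongrightarrow> f x" if "x \<notin> N'" for x
  proof -
    have "(\<lambda>n. u n x) \<longlonglongrightarrow> max 0 (min c (f x)) * max 0 (min 1 (R + 1 - norm x))"
      unfolding u_def using that N'(2) by (intro tendsto_intros lim) auto
    also have "max 0 (min c (f x)) * max 0 (min 1 (R + 1 - norm x)) = f x"
      using f0[of x] fc[of x] fR[of x] by (cases "norm x > R") (auto simp: min_def max_def)
    finally show ?thesis .
  qed
  have limM: "(\<lambda>n. \<integral>\<^sup>+x. ennreal (u n x) \<partial>M) \<longlonglongrightarrow> (\<integral>\<^sup>+x. ennreal (f x) \<partial>M)"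
  proof (rule nn_integral_dominated_convergence[where w="\<lambda>_. ennreal c"])
    show "AE x in M. ennreal (u n x) \<le> ennreal c" for n
      using ub[of n] c0 by (intro AE_I2 ennreal_leI order_trans[OF ub]) (auto simp: indicator_def)
    show "AE x in M. (\<lambda>n. ennreal (u n x)) \<longlonglongrightarrow> ennreal (f x)"
      using N'M by (rule AE_I') (auto dest: ul intro: tendsto_ennrealI)
  qed (auto simp: emeasure_space_1)
  have limL: "(\<lambda>n. \<integral>\<^sup>+x. (ennreal (u n x))\<^sup>2 \<partial>lborel) \<longlonglongrightarrow> (\<integral>\<^sup>+x. (ennreal (f x))\<^sup>2 \<partial>lborel)"
  proof (rule nn_integral_dominated_convergence[where w="\<lambda>x. ennreal (c\<^sup>2) * indicator (cball 0 (R + 1)) x"])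
    have "(ennreal (u n x))\<^sup>2 \<le> ennreal (c\<^sup>2) * indicator (cball 0 (R + 1)) x" for n x
    proof -
      have "(u n x)\<^sup>2 \<le> (c * indicator (cball 0 (R + 1)) x)\<^sup>2" by (intro power_mono ub u0)
      then show ?thesis using u0[of n x] c0
        by (auto simp: indicator_def ennreal_power split: if_splits)
    qed
    then show "AE x in lborel. (ennreal (u n x))\<^sup>2 \<le> ennreal (c\<^sup>2) * indicator (cball 0 (R + 1)) x" for n by simp
    show "(\<integral>\<^sup>+x. ennreal (c\<^sup>2) * indicator (cball 0 (R + 1)) (x :: 'a) \<partial>lborel) < \<infinity>"
      by (simp add: nn_integral_cmult_indicator ennreal_mult_less_top emeasure_lborel_cball_finite[unfolded infinity_ennreal_def])
    have "(\<lambda>n. (ennreal (u n x))\<^sup>2) \<longlonglongrightarrow> (ennreal (f x))\<^sup>2" if "x \<notin> N'" for x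
      using tendsto_ennrealI[OF tendsto_power[OF ul[OF that], of 2]] by (simp add: ennreal_power u0 f0)
    then show "AE x in lborel. (\<lambda>n. (ennreal (u n x))\<^sup>2) \<longlonglongrightarrow> (ennreal (f x))\<^sup>2"
      by (intro AE_I'[OF N'(1)]) auto
  qed auto
  have bound: "(\<integral>\<^sup>+x. ennreal (u n x) \<partial>M)\<^sup>2 \<le> fourier_energy M * (\<integral>\<^sup>+x. (ennreal (u n x))\<^sup>2 \<partial>lborel)" for n
  proof (rule L2_bound_seq_lsc[OF assms(1,2)])
    fix x and w :: "nat \<Rightarrow> 'a" assume "w \<longlonglongrightarrow> x"
    then have "(\<lambda>k. u n (w k)) \<longlonglongrightarrow> u n x"
      using continuous_on_tendsto_compose[OF uc, of w x sequentially n] by simp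
    then show "ennreal (u n x) \<le> liminf (\<lambda>k. ennreal (u n (w k)))"
      using lim_imp_Liminf[OF trivial_limit_sequentially tendsto_ennrealI] by (metis order_refl)
  qed measurable
  show ?thesis
  proof (rule LIMSEQ_le)
    show "(\<lambda>n. (\<integral>\<^sup>+x. ennreal (u n x) \<partial>M)\<^sup>2) \<longlonglongrightarrow> (\<integral>\<^sup>+x. ennreal (f x) \<partial>M)\<^sup>2"
      unfolding power2_eq_square by (intro tendsto_mult_ennreal limM) auto
    show "(\<lambda>n. fourier_energy M * (\<integral>\<^sup>+x. (ennreal (u n x))\<^sup>2 \<partial>lborel)) \<longlonglongrightarrow> fourier_energy M * (\<integral>\<^sup>+x. (ennreal (f x))\<^sup>2 \<partial>lborel)"
      using E by (intro ennreal_tendsto_cmult limL) auto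
  qed (use bound in auto)
qed

text \<open>
  For a truncation \<open>f\<close> of the density \<open>h\<close>, put \<open>I = \<integral> f\<^sup>2\<close>, which is finite. From
  \<open>I \<le> \<integral> f h = \<integral> f dM\<close> and the previous inequality, \<open>I\<^sup>2 \<le> E I\<close>, hence \<open>I \<le> E\<close>.
  The truncations converge to \<open>h\<close>, and Fatou's lemma concludes.
\<close>
lemma RN_deriv_L2_bound:
  fixes M :: "'a::euclidean_space measure"
  assumes "prob_space M" and M[measurable_cong]: "sets M = sets borel" and E: "fourier_energy M < \<infinity>"
  shows "(\<integral>\<^sup>+x. (RN_deriv lborel M x)\<^sup>2 \<partial>lborel) \<le> fourier_energy M"
proof -
  define h where "h = RN_deriv lborel M"
  have h[measurable]: "h \<in> borel_measurable borel" unfolding h_def by measurable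
  have dens: "density lborel h = M"
    unfolding h_def using absolutely_continuous_if_finite_energy[OF assms] M
    by (intro sigma_finite_measure.density_RN_deriv[OF sigma_finite_lborel]) auto
  \<comment> \<open>The minimum is finite even where \<open>h\<close> is infinite, so that \<open>enn2real\<close> loses nothing.\<close>
  define f where "f k x = enn2real (min (h x) (of_nat k)) * indicator (ball 0 (real k)) x" for k :: nat and x
  have fe: "ennreal (f k x) = min (h x) (of_nat k) * indicator (ball 0 (real k)) x" for k x
  proof -
    have "min (h x) (of_nat k) < top" by (simp add: min_less_iff_disj of_nat_less_top)
    then show ?thesis by (simp add: f_def indicator_def)
  qed
  have [measurable]: "ball 0 r \<in> sets (borel :: 'a measure)" for r by simp
  have [measurable]: "f k \<in> borel_measurable borel" for k unfolding f_def by measurable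
  have fh: "ennreal (f k x) \<le> h x" for k x by (simp add: fe indicator_def)
  have fk: "f k x \<le> real k" for k x
  proof -
    have "ennreal (f k x) \<le> ennreal (real k)" by (simp add: fe indicator_def ennreal_of_nat_eq_real_of_nat)
    then show ?thesis by simp
  qed
  have bound: "(\<integral>\<^sup>+x. (ennreal (f k x))\<^sup>2 \<partial>lborel) \<le> fourier_energy M" for k
  proof -
    let ?I = "\<integral>\<^sup>+x. (ennreal (f k x))\<^sup>2 \<partial>lborel"
    have "?I \<le> (\<integral>\<^sup>+x. ennreal ((real k)\<^sup>2) * indicator (ball 0 (real k)) (x :: 'a) \<partial>lborel)"
    proof (rule nn_integral_mono)
      fix x :: 'a
      have "f k x \<ge> 0" by (simp add: f_def)
      then show "(ennreal (f k x))\<^sup>2 \<le> ennreal ((real k)\<^sup>2) * indicator (ball 0 (real k)) x"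
        using power_mono[OF fk[of k x], of 2]
        by (cases "x \<in> ball 0 (real k)") (auto simp: ennreal_power f_def)
    qed
    also have "\<dots> < \<infinity>"
      by (simp add: nn_integral_cmult_indicator ennreal_mult_less_top emeasure_lborel_ball_finite[unfolded infinity_ennreal_def])
    finally have fin: "?I < \<infinity>" .
    have "?I \<le> (\<integral>\<^sup>+x. h x * ennreal (f k x) \<partial>lborel)"
      unfolding power2_eq_square by (intro nn_integral_mono mult_right_mono fh) auto
    also have "\<dots> = (\<integral>\<^sup>+x. ennreal (f k x) \<partial>M)"
      by (subst dens[symmetric], subst nn_integral_density) auto
    finally have "?I\<^sup>2 \<le> (\<integral>\<^sup>+x. ennreal (f k x) \<partial>M)\<^sup>2" by (rule power_mono) simp
    also have "\<dots> \<le> fourier_energy M * ?I"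
      by (rule L2_bound_bounded_compact_support[OF assms, where c="real k" and R="real k"])
         (auto simp: fk, auto simp: f_def)
    finally have "?I * ?I \<le> ?I * fourier_energy M"
      by (simp add: power2_eq_square mult.commute[of "fourier_energy M"])
    then show ?thesis using fin
      by (cases "?I = 0") (auto simp: ennreal_mult_le_mult_iff)
  qed
  have lim: "(\<lambda>k. (ennreal (f k x))\<^sup>2) \<longlonglongrightarrow> (h x)\<^sup>2" for x
  proof -
    have "(\<lambda>k. min (h x) (of_nat k)) \<longlonglongrightarrow> min (h x) top"
      by (intro tendsto_min tendsto_const of_nat_tendsto_top_ennreal)
    moreover have "eventually (\<lambda>k. min (h x) (of_nat k) = ennreal (f k x)) sequentially"
      using eventually_gt_at_top[of "nat \<lceil>norm x\<rceil>"]
    proof eventually_elim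
      case (elim k)
      then have "norm x < real k" by linarith
      then show ?case by (simp add: fe)
    qed
    ultimately have "(\<lambda>k. ennreal (f k x)) \<longlonglongrightarrow> h x"
      using Lim_transform_eventually[of "\<lambda>k. min (h x) (of_nat k)" "h x" sequentially "\<lambda>k. ennreal (f k x)"]
      by (simp add: min_top2)
    then show ?thesis unfolding power2_eq_square by (intro tendsto_mult_ennreal) auto
  qed
  have "(\<integral>\<^sup>+x. (h x)\<^sup>2 \<partial>lborel) = (\<integral>\<^sup>+x. liminf (\<lambda>k. (ennreal (f k x))\<^sup>2) \<partial>lborel)"
    by (intro nn_integral_cong lim_imp_Liminf[OF trivial_limit_sequentially lim, symmetric])
  also have "\<dots> \<le> liminf (\<lambda>k. \<integral>\<^sup>+x. (ennreal (f k x))\<^sup>2 \<partial>lborel)"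
    by (rule nn_integral_liminf) measurable
  also have "\<dots> \<le> fourier_energy M"
    by (intro Liminf_le) (auto simp: bound)
  finally show ?thesis unfolding h_def .
qed

section \<open>Bessel measures of positive lower density\<close>

text \<open>
  Modulating the measure by a character translates its Fourier transform; characters have
  norm 1 because the measure has mass 1.
\<close>
lemma bessel_translate:
  fixes M N :: "'a::euclidean_space measure"
  assumes "prob_space M" and [measurable_cong]: "sets M = sets borel" and "bessel_measure M N"
  obtains B where "B > 0" and "\<And>s. (\<integral>\<^sup>+t. ennreal ((cmod (fourier_stieltjes M (t + s)))\<^sup>2) \<partial>N) \<le> ennreal B"
proof -
  interpret prob_space M by fact
  obtain B where B: "B > 0" and bes: "\<And>f. f \<in> L2_functions M \<Longrightarrow>
      (\<integral>\<^sup>+ t. ennreal ((cmod (fourier_measure f M t))\<^sup>2) \<partial>N) \<le> ennreal (B * (LINT x|M. (cmod (f x))\<^sup>2))"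
    using assms(3) unfolding bessel_measure_def by blast
  have "(\<integral>\<^sup>+t. ennreal ((cmod (fourier_stieltjes M (t + s)))\<^sup>2) \<partial>N) \<le> ennreal B" for s
  proof -
    have "character s \<in> L2_functions M" by (simp add: L2_functions_def)
    moreover have "fourier_measure (character s) M t = fourier_stieltjes M (t + s)" for t
      unfolding fourier_measure_def
      by (intro Bochner_Integration.integral_cong) (auto simp: exp_add[symmetric] inner_add_left algebra_simps)
    ultimately show ?thesis using bes[of "character s"] by (simp add: prob_space)
  qed
  with B that show ?thesis by blast
qed

text \<open>
  The transform is continuous and equals 1 at the origin, so its square is at least
  \<open>1 / 4\<close> on a ball. By the translated Bessel inequality, every ball of that radius has
  bounded \<open>N\<close>-measure, and countably many of them cover the space. This makes Tonelli's
  theorem available for \<open>N\<close>.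
\<close>
lemma sigma_finite_bessel:
  fixes M N :: "'a::euclidean_space measure"
  assumes "prob_space M" and "sets M = sets borel" and bessel: "bessel_measure M N"
  shows "sigma_finite_measure N"
proof -
  interpret prob_space M by fact
  let ?F = "fourier_stieltjes M"
  have sN: "sets N = sets borel" using bessel by (simp add: bessel_measure_def)
  then have spN: "space N = UNIV" using sets_eq_imp_space_eq[OF sN] by simp
  note [measurable_cong] = sN
  have Fc: "continuous_on UNIV ?F" by (rule continuous_fourier_stieltjes[OF assms(1,2)])
  have [measurable]: "?F \<in> borel_measurable borel" by (rule borel_measurable_continuous_onI[OF Fc])
  obtain B where B: "\<And>s. (\<integral>\<^sup>+t. ennreal ((cmod (?F (t + s)))\<^sup>2) \<partial>N) \<le> ennreal B"
    using bessel_translate[OF assms] by blast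
  have F0: "?F 0 = 1" by (simp add: fourier_measure_def prob_space)
  obtain d where d: "d > 0" and dF: "\<And>u. dist u 0 < d \<Longrightarrow> dist (?F u) (?F 0) < 1/2"
    using Fc unfolding continuous_on_iff by (metis UNIV_I half_gt_zero_iff zero_less_one)
  have ball: "emeasure N (ball p d) \<noteq> \<infinity>" for p
  proof -
    have "ennreal (1/4) * emeasure N (ball p d) = (\<integral>\<^sup>+t. ennreal (1/4) * indicator (ball p d) t \<partial>N)"
      by (subst nn_integral_cmult_indicator) auto
    also have "\<dots> \<le> (\<integral>\<^sup>+t. ennreal ((cmod (?F (t + (- p))))\<^sup>2) \<partial>N)"
    proof (rule nn_integral_mono)
      fix t
      show "ennreal (1/4) * indicator (ball p d) t \<le> ennreal ((cmod (?F (t + (- p))))\<^sup>2)"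
      proof (cases "t \<in> ball p d")
        case True
        then have "dist (?F (t + (- p))) 1 < 1/2"
          using dF[of "t + (- p)"] F0 by (simp add: dist_norm norm_minus_commute)
        then have "1/2 \<le> cmod (?F (t + (- p)))"
          using norm_triangle_ineq2[of 1 "?F (t + (- p))"] by (simp add: dist_norm norm_minus_commute)
        then have "(1/2)\<^sup>2 \<le> (cmod (?F (t + (- p))))\<^sup>2" by (intro power_mono) auto
        then show ?thesis using True by (simp add: power2_eq_square)
      qed simp
    qed
    also have "\<dots> \<le> ennreal B" by (rule B)
    finally show ?thesis by (auto simp: ennreal_mult_top top_unique)
  qed
  obtain D :: "'a set" where D: "countable D" "\<And>X. open X \<Longrightarrow> X \<noteq> {} \<Longrightarrow> \<exists>p\<in>D. p \<in> X"
    using countable_dense_exists by metis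
  show ?thesis
  proof (rule sigma_finite_measure.intro, intro exI conjI)
    show "countable ((\<lambda>p. ball p d) ` D)" using D by simp
    show "(\<lambda>p. ball p d) ` D \<subseteq> sets N" unfolding sN by auto
    have "\<exists>p\<in>D. t \<in> ball p d" for t
    proof -
      have "ball t d \<noteq> {}" using d by simp
      then obtain p where "p \<in> D" "p \<in> ball t d" using D(2)[OF open_ball] by blast
      then show ?thesis by (metis dist_commute mem_ball)
    qed
    then show "\<Union> ((\<lambda>p. ball p d) ` D) = space N" unfolding spN by auto
    show "\<forall>a\<in>(\<lambda>p. ball p d) ` D. emeasure N a \<noteq> \<infinity>" using ball by auto
  qed
qed

text \<open>
  A positive lower limit yields a scale \<open>R\<close> at which all cubes have measure at least
  \<open>c\<close>. The cubes are rewritten through \<open>t - x\<close>, which turns their measure into an integral that can be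
  exchanged with one over \<open>x\<close>.
\<close>
lemma uniform_cube_bound:
  fixes N :: "'a::euclidean_space measure"
  assumes "lower_beurling_density N > 0"
  obtains R c where "R > 0" and "c > 0" and "\<And>x. c \<le> emeasure N {t. \<forall>b\<in>Basis. 0 \<le> (t - x) \<bullet> b \<and> (t - x) \<bullet> b < R}"
proof -
  let ?I = "\<lambda>R. INF x. emeasure N ((\<lambda>q. x + R *\<^sub>R q) ` unit_cube) / ennreal (R ^ DIM('a))"
  obtain y where y: "0 < y" "y < Liminf at_top ?I"
    using dense assms unfolding lower_beurling_density_def by blast
  have "eventually (\<lambda>R::real. y < ?I R \<and> 0 < R) at_top"
    using less_LiminfD[OF y(2)] eventually_gt_at_top by (rule eventually_conj)
  then obtain R where R: "y < ?I R" "0 < R"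
    using eventually_happens[of _ "at_top :: real filter"] by auto
  let ?v = "ennreal (R ^ DIM('a))"
  have cube: "(\<lambda>q. x + R *\<^sub>R q) ` unit_cube = {t. \<forall>b\<in>Basis. 0 \<le> (t - x) \<bullet> b \<and> (t - x) \<bullet> b < R}" for x :: 'a
  proof (intro set_eqI iffI)
    fix t assume "t \<in> (\<lambda>q. x + R *\<^sub>R q) ` unit_cube"
    then show "t \<in> {t. \<forall>b\<in>Basis. 0 \<le> (t - x) \<bullet> b \<and> (t - x) \<bullet> b < R}"
      using R(2) by (auto simp: unit_cube_def)
  next
    fix t assume "t \<in> {t. \<forall>b\<in>Basis. 0 \<le> (t - x) \<bullet> b \<and> (t - x) \<bullet> b < R}"
    then have "(1 / R) *\<^sub>R (t - x) \<in> unit_cube" using R(2) by (auto simp: unit_cube_def)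
    moreover have "t = x + R *\<^sub>R ((1 / R) *\<^sub>R (t - x))" using R(2) by simp
    ultimately show "t \<in> (\<lambda>q. x + R *\<^sub>R q) ` unit_cube" by blast
  qed
  show ?thesis
  proof
    show "R > 0" by fact
    show "y * ?v > 0" using y R(2) by (simp add: ennreal_zero_less_mult_iff)
    fix x :: 'a
    let ?e = "emeasure N ((\<lambda>q. x + R *\<^sub>R q) ` unit_cube)"
    have "y \<le> ?e / ?v" using R(1) INF_lower[of x UNIV "\<lambda>x. emeasure N ((\<lambda>q. x + R *\<^sub>R q) ` unit_cube) / ?v"]
      by (simp add: order.strict_implies_order order_less_le_trans)
    then have "y * ?v \<le> ?e / ?v * ?v" by (rule mult_right_mono) simp
    also have "\<dots> = ?e" using R(2) by (simp add: ennreal_divide_times ennreal_times_divide ennreal_mult_divide_eq)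
    finally show "y * ?v \<le> emeasure N {t. \<forall>b\<in>Basis. 0 \<le> (t - x) \<bullet> b \<and> (t - x) \<bullet> b < R}"
      unfolding cube .
  qed
qed

text \<open>
  With \<open>C\<close> the cube of side \<open>R\<close> at the origin, \<open>c E\<close> is at most the double integral of
  \<open>|F u|\<^sup>2\<close> over all \<open>t - u \<in> C\<close>. The substitution \<open>u = t + s\<close> confines \<open>s\<close> to the bounded set
  \<open>- C\<close> and leaves the Bessel integral of a translate inside.
\<close>
lemma fourier_energy_finite:
  fixes M N :: "'a::euclidean_space measure"
  assumes "prob_space M" and "sets M = sets borel" and bessel: "bessel_measure M N"
    and dens: "lower_beurling_density N > 0"
  shows "fourier_energy M < \<infinity>"
proof -
  interpret sigma_finite_measure N by (rule sigma_finite_bessel[OF assms(1-3)])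
  interpret pair_sigma_finite N lborel ..
  let ?F = "fourier_stieltjes M"
  let ?f = "\<lambda>u. ennreal ((cmod (?F u))\<^sup>2)"
  have sN[measurable_cong]: "sets N = sets borel" using bessel by (simp add: bessel_measure_def)
  have [measurable]: "?F \<in> borel_measurable borel"
    by (rule borel_measurable_continuous_onI[OF continuous_fourier_stieltjes[OF assms(1,2)]])
  obtain B where B: "\<And>s. (\<integral>\<^sup>+t. ?f (t + s) \<partial>N) \<le> ennreal B"
    using bessel_translate[OF assms(1-3)] by blast
  obtain R c where R: "R > 0" and c: "c > 0"
    and cube: "\<And>x. c \<le> emeasure N {t. \<forall>b\<in>Basis. 0 \<le> (t - x) \<bullet> b \<and> (t - x) \<bullet> b < R}"
    using uniform_cube_bound[OF dens] by blast
  define C where "C = {q::'a. \<forall>b\<in>Basis. 0 \<le> q \<bullet> b \<and> q \<bullet> b < R}"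
  have "C = (\<Inter>b\<in>Basis. {q. 0 \<le> q \<bullet> b \<and> q \<bullet> b < R})" by (auto simp: C_def)
  also have "\<dots> \<in> sets borel"
    by (intro sets.finite_INT finite_Basis nonempty_Basis) measurable
  finally have [measurable]: "C \<in> sets borel" .
  have cube': "c \<le> (\<integral>\<^sup>+t. indicator C (t - x) \<partial>N)" for x
  proof -
    have m: "(\<lambda>t. t - x) -` C \<in> sets N"
      unfolding sN using measurable_sets[of "\<lambda>t. t - x" borel borel C] by simp
    have "(\<integral>\<^sup>+t. indicator C (t - x) \<partial>N) = (\<integral>\<^sup>+t. indicator ((\<lambda>t. t - x) -` C) t \<partial>N)"
      by (intro nn_integral_cong) (simp add: indicator_def)
    also have "\<dots> = emeasure N ((\<lambda>t. t - x) -` C)" using m by simp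
    also have "(\<lambda>t. t - x) -` C = {t. \<forall>b\<in>Basis. 0 \<le> (t - x) \<bullet> b \<and> (t - x) \<bullet> b < R}"
      by (auto simp: C_def)
    finally show ?thesis using cube[of x] by simp
  qed
  have "c * fourier_energy M = (\<integral>\<^sup>+u. ?f u * c \<partial>lborel)"
    unfolding fourier_energy_def by (subst mult.commute, rule nn_integral_multc[symmetric]) measurable
  also have "\<dots> \<le> (\<integral>\<^sup>+u. ?f u * (\<integral>\<^sup>+t. indicator C (t - u) \<partial>N) \<partial>lborel)"
    by (intro nn_integral_mono mult_left_mono cube') auto
  also have "\<dots> = (\<integral>\<^sup>+u. \<integral>\<^sup>+t. ?f u * indicator C (t - u) \<partial>N \<partial>lborel)"
    by (simp add: nn_integral_cmult)
  also have "\<dots> = (\<integral>\<^sup>+t. \<integral>\<^sup>+u. ?f u * indicator C (t - u) \<partial>lborel \<partial>N)"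
    by (rule Fubini') measurable
  also have "\<dots> = (\<integral>\<^sup>+t. \<integral>\<^sup>+s. ?f (t + s) * indicator C (t - (t + s)) \<partial>lborel \<partial>N)"
    by (intro nn_integral_cong nn_integral_lborel_translate[symmetric]) measurable
  also have "\<dots> = (\<integral>\<^sup>+s. \<integral>\<^sup>+t. ?f (t + s) * indicator C (- s) \<partial>N \<partial>lborel)"
    by (simp, rule Fubini'[symmetric]) measurable
  also have "\<dots> = (\<integral>\<^sup>+s. (\<integral>\<^sup>+t. ?f (t + s) \<partial>N) * indicator C (- s) \<partial>lborel)"
    by (intro nn_integral_cong nn_integral_multc) measurable
  also have "\<dots> \<le> (\<integral>\<^sup>+s. ennreal B * indicator (cbox (- (R *\<^sub>R One)) 0) (s::'a) \<partial>lborel)"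
  proof (intro nn_integral_mono mult_mono B)
    fix s :: 'a
    show "(indicator C (- s) :: ennreal) \<le> indicator (cbox (- (R *\<^sub>R One)) 0) s"
      by (auto simp: indicator_def C_def cbox_def minus_le_iff less_imp_le)
  qed auto
  also have "\<dots> < \<infinity>"
    by (simp add: nn_integral_cmult_indicator ennreal_mult_less_top emeasure_lborel_cbox_finite[unfolded infinity_ennreal_def])
  finally show ?thesis using c by (auto simp: ennreal_mult_less_top)
qed

theorem theorem3p10:
  fixes \<mu> \<nu> :: "'a::euclidean_space measure"
  assumes "prob_space \<mu>" and "sets \<mu> = sets borel"
    and "compact (measure_support \<mu>)"
    and "bessel_measure \<mu> \<nu>"
    and "lower_beurling_density \<nu> > 0"
  shows "absolutely_continuous lborel \<mu> \<and>
    (\<integral>\<^sup>+ x. (RN_deriv lborel \<mu> x)\<^sup>2 \<partial>lborel) < \<infinity>"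
proof -
  have E: "fourier_energy \<mu> < \<infinity>"
    by (rule fourier_energy_finite[OF assms(1,2,4,5)])
  have "(\<integral>\<^sup>+ x. (RN_deriv lborel \<mu> x)\<^sup>2 \<partial>lborel) < \<infinity>"
    using RN_deriv_L2_bound[OF assms(1,2) E] E by (rule le_less_trans)
  with absolutely_continuous_if_finite_energy[OF assms(1,2) E] show ?thesis ..
qed

end
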